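(* Let $w(\delta)=\prod_{i=1}^{p}w_i(\delta_i)$ for $\delta=(\delta_1,\ldots,\delta_p)^T\in\mathbb{R}^p$, where each $w_i$ is a probability density function on $\mathbb{R}$ with mean $\alpha_i$ and variance $\beta_i^2$, $i\in\{1,\ldots,p\}$. Define $$T_n=\int_{\mathbb{R}^p}(C\hat\mu)^T(I_q\otimes\delta\delta^T)(C\hat\mu)\,w(\delta)\,d\delta=\int_{\mathbb{R}^p}\|(I_q\otimes\delta^T)C\hat\mu\|^2\,w(\delta)\,d\delta .$$ Then $$T_n=\hat\mu^T(H\otimes W_p)\hat\mu,$$ where $H=G^TG=\tilde G^T(\tilde G D\tilde G^T)^{-1}\tilde G$ and $W_p=\mathrm{diag}(\beta_1^2,\ldots,\beta_p^2)+aa^T$ with $a=(\alpha_1,\ldots,\alpha_p)^T$.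
   Context: There are $k$ independent samples; the $i$-th sample $\mathbf{y}_{i1},\ldots,\mathbf{y}_{in_i}$ consists of i.i.d. random vectors in $\mathbb{R}^p$ with mean vector $\mu_i$ and covariance matrix $\Sigma_i$, $i\in\{1,\ldots,k\}$. Let $\bar y_i$ be the sample mean of the $i$-th sample and $\hat\mu=(\bar y_1^T,\ldots,\bar y_k^T)^T\in\mathbb{R}^{kp}$. $\tilde G$ is a known $q\times k$ real matrix of full row rank $q<k$, $D=\mathrm{diag}(1/n_1,\ldots,1/n_k)$, $G=(\tilde GD\tilde G^T)^{-1/2}\tilde G$, and $C=G\otimes I_p$, where $\otimes$ is the Kronecker product and $I_p$ is the $p\times p$ identity matrix. *)

theory Defs
  imports "HOL-Probability.Probability"
begin

text \<open>
  Vectors in \<open>R^(k*p)\<close> and matrices of block format are indexed by pairs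
  (block index, index inside the block). In particular the Kronecker product of an
  \<open>m \<times> n\<close> and an \<open>m' \<times> n'\<close> matrix has rows indexed by \<open>'m \<times> 'm'\<close> and columns by \<open>'n \<times> 'n'\<close>.
\<close>

definition kronecker :: "real^'n^'m \<Rightarrow> real^'b^'a \<Rightarrow> real^('n \<times> 'b)^('m \<times> 'a)" where
  "kronecker A B = (\<chi> r s. A $ fst r $ fst s * B $ snd r $ snd s)"

definition diag_matrix :: "real^'n \<Rightarrow> real^'n^'n" where
  "diag_matrix d = (\<chi> i j. if i = j then d $ i else 0)"

definition outer :: "real^'n \<Rightarrow> real^'n^'n" where
  "outer v = (columnvector v :: real^1^'n) ** (rowvector v :: real^'n^1)"

text \<open>
  The principal square root, i.e. the unique symmetric positive semidefinite one. It exists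
  whenever the argument is symmetric positive semidefinite.
\<close>

definition matrix_sqrt :: "real^'n^'n \<Rightarrow> real^'n^'n" where
  "matrix_sqrt A = (THE B. transpose B = B \<and> (\<forall>x. 0 \<le> x \<bullet> (B *v x)) \<and> B ** B = A)"

definition matrix_inv_sqrt :: "real^'n^'n \<Rightarrow> real^'n^'n" where
  "matrix_inv_sqrt A = matrix_inv (matrix_sqrt A)"

text \<open>
  Observation \<open>j \<in> {1..n i}\<close> of sample \<open>i\<close> is the random vector \<open>y i j\<close>. Independence of the
  whole family covers both independence within and independence between the samples.
\<close>

locale k_samples = prob_space M
  for M :: "'w measure"
    and n :: "'k::finite \<Rightarrow> nat"
    and y :: "'k \<Rightarrow> nat \<Rightarrow> 'w \<Rightarrow> real^'p"
    and \<mu> :: "'k \<Rightarrow> real^'p"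
    and \<Sigma> :: "'k \<Rightarrow> real^'p^'p" +
  assumes sample_size: "1 \<le> n i"
    and indep: "indep_vars (\<lambda>_. borel) (\<lambda>(i, j). y i j) (SIGMA i:UNIV. {1..n i})"
    and ident_distr: "j \<in> {1..n i} \<Longrightarrow> distr M borel (y i j) = distr M borel (y i 1)"
    and mean: "j \<in> {1..n i} \<Longrightarrow> has_bochner_integral M (y i j) (\<mu> i)"
    and covariance: "j \<in> {1..n i} \<Longrightarrow>
      has_bochner_integral M (\<lambda>\<omega>. (y i j \<omega> $ a - \<mu> i $ a) * (y i j \<omega> $ b - \<mu> i $ b))
        (\<Sigma> i $ a $ b)"

definition sample_mean :: "nat \<Rightarrow> (nat \<Rightarrow> 'w \<Rightarrow> real^'p) \<Rightarrow> 'w \<Rightarrow> real^'p" where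
  "sample_mean m x \<omega> = (1 / real m) *\<^sub>R (\<Sum>j=1..m. x j \<omega>)"

definition mu_hat ::
  "('k::finite \<Rightarrow> nat) \<Rightarrow> ('k \<Rightarrow> nat \<Rightarrow> 'w \<Rightarrow> real^'p) \<Rightarrow> 'w \<Rightarrow> real^('k \<times> 'p)" where
  "mu_hat n y \<omega> = (\<chi> r. sample_mean (n (fst r)) (y (fst r)) \<omega> $ snd r)"

definition D_matrix :: "('k::finite \<Rightarrow> nat) \<Rightarrow> real^'k^'k" where
  "D_matrix n = diag_matrix (\<chi> i. 1 / real (n i))"

definition G_matrix :: "('k::finite \<Rightarrow> nat) \<Rightarrow> real^'k^'q \<Rightarrow> real^'k^'q" where
  "G_matrix n Gt = matrix_inv_sqrt (Gt ** D_matrix n ** transpose Gt) ** Gt"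

definition C_matrix :: "('k::finite \<Rightarrow> nat) \<Rightarrow> real^'k^'q \<Rightarrow> real^('k \<times> 'p::finite)^('q \<times> 'p)" where
  "C_matrix n Gt = kronecker (G_matrix n Gt) (mat 1)"

definition H_matrix :: "('k::finite \<Rightarrow> nat) \<Rightarrow> real^'k^'q \<Rightarrow> real^'k^'k" where
  "H_matrix n Gt = transpose (G_matrix n Gt) ** G_matrix n Gt"

definition W_matrix :: "real^'p \<Rightarrow> real^'p \<Rightarrow> real^'p^'p" where
  "W_matrix \<alpha> \<beta> = diag_matrix (\<chi> i. (\<beta> $ i)\<^sup>2) + outer \<alpha>"

definition prob_density_fun :: "(real \<Rightarrow> real) \<Rightarrow> bool" where
  "prob_density_fun f \<longleftrightarrow>
     f \<in> borel_measurable borel \<and> (\<forall>x. 0 \<le> f x) \<and> has_bochner_integral lborel f 1"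

definition has_mean_variance :: "(real \<Rightarrow> real) \<Rightarrow> real \<Rightarrow> real \<Rightarrow> bool" where
  "has_mean_variance f m v \<longleftrightarrow>
     has_bochner_integral lborel (\<lambda>x. x * f x) m \<and>
     has_bochner_integral lborel (\<lambda>x. (x - m)\<^sup>2 * f x) v"

definition prod_density :: "('p::finite \<Rightarrow> real \<Rightarrow> real) \<Rightarrow> real^'p \<Rightarrow> real" where
  "prod_density w \<delta> = (\<Prod>i\<in>UNIV. w i (\<delta> $ i))"

definition T_integrand ::
  "real^('k::finite \<times> 'p::finite)^('q::finite \<times> 'p) \<Rightarrow> ('p \<Rightarrow> real \<Rightarrow> real) \<Rightarrow> real^('k \<times> 'p)
    \<Rightarrow> real^'p \<Rightarrow> real" where
  "T_integrand C w m \<delta> =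
     ((C *v m) \<bullet> (kronecker (mat 1 :: real^'q^'q) (outer \<delta>) *v (C *v m))) * prod_density w \<delta>"

definition T_stat ::
  "real^('k::finite \<times> 'p::finite)^('q::finite \<times> 'p) \<Rightarrow> ('p \<Rightarrow> real \<Rightarrow> real) \<Rightarrow> real^('k \<times> 'p)
    \<Rightarrow> real" where
  "T_stat C w m = (\<integral>\<delta>. T_integrand C w m \<delta> \<partial>lborel)"

text \<open>The integrand in norm form; here \<open>\<delta>\<^sup>T\<close> is a matrix with a single row.\<close>

definition T_norm_integrand ::
  "real^('k::finite \<times> 'p::finite)^('q::finite \<times> 'p) \<Rightarrow> ('p \<Rightarrow> real \<Rightarrow> real) \<Rightarrow> real^('k \<times> 'p)
    \<Rightarrow> real^'p \<Rightarrow> real" where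
  "T_norm_integrand C w m \<delta> =
     (norm (kronecker (mat 1 :: real^'q^'q) (rowvector \<delta> :: real^'p^1) *v (C *v m)))\<^sup>2
       * prod_density w \<delta>"

end

theory Submission imports Defs begin

text \<open>
  The second moments \<open>\<integral> \<delta>\<^sub>a \<delta>\<^sub>b w(\<delta>) d\<delta>\<close> factor over the coordinates (Lebesgue measure is a product
  measure) and are exactly the entries of \<open>W\<close>. By linearity
  \<open>T = (C m) \<bullet> (I \<otimes> W) (C m)\<close>, and the mixed product rule turns
  \<open>(G \<otimes> I)\<^sup>T (I \<otimes> W) (G \<otimes> I)\<close> into \<open>G\<^sup>T G \<otimes> W\<close>. For the formula for \<open>H\<close> one needs that the
  principal square root exists and is unique; existence comes from an orthonormal eigenbasis,
  obtained as a maximal orthonormal set of eigenvectors.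
\<close>

section \<open>Spectral theorem for self-adjoint maps\<close>

lemma inner_matrix_transpose:
  fixes A :: "real^'n^'m"
  shows "x \<bullet> (A *v y) = (transpose A *v x) \<bullet> y"
  by (simp add: dot_lmul_matrix)

text \<open>Moving from \<open>v\<close> by \<open>t\<close> times \<open>h v\<close> changes the
  form, to first order in \<open>t\<close>, by twice \<open>t\<close> times the squared norm of
  \<open>h v\<close>. Unless \<open>h v = 0\<close>, a suitable negative \<open>t\<close> therefore
  makes it negative.\<close>

lemma positive_semidefinite_kernel:
  fixes h :: "'a::real_inner \<Rightarrow> 'a"
  assumes lin: "linear h" and self: "\<And>x y. h x \<bullet> y = x \<bullet> h y"
    and S: "subspace S" "h ` S \<subseteq> S" and psd: "\<And>x. x \<in> S \<Longrightarrow> 0 \<le> x \<bullet> h x"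
    and v: "v \<in> S" "v \<bullet> h v = 0"
  shows "h v = 0"
proof (rule ccontr)
  assume "h v \<noteq> 0"
  define z where "z = h v"
  define a where "a = z \<bullet> z"
  define c where "c = z \<bullet> h z"
  have a: "a > 0" using \<open>h v \<noteq> 0\<close> by (simp add: a_def z_def)
  have z: "z \<in> S" using v S by (auto simp: z_def)
  then have c: "c \<ge> 0" using psd by (simp add: c_def)
  \<comment> \<open>The denominator is positive even if \<open>c = 0\<close>, and
    \<open>t * c = - a - t\<close> turns the factor \<open>2 * a + t * c\<close> into
    \<open>a - t > 0\<close>.\<close>
  define t where "t = - a / (1 + c)"
  have t: "t * (1 + c) = - a" using c by (simp add: t_def)
  have "t < 0" using a c by (simp add: t_def)
  have "v + t *\<^sub>R z \<in> S"
    using v z S by (simp add: subspace_add subspace_scale)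
  then have "0 \<le> (v + t *\<^sub>R z) \<bullet> h (v + t *\<^sub>R z)" by (rule psd)
  also have "\<dots> = v \<bullet> h v + t * (v \<bullet> h z) + t * (z \<bullet> h v) + t * t * (z \<bullet> h z)"
    by (simp add: linear_add[OF lin] linear_scale[OF lin] algebra_simps)
  also have "v \<bullet> h z = a"
    by (simp add: self[symmetric] a_def z_def)
  also have "z \<bullet> h v = a" by (simp add: a_def z_def)
  finally have "0 \<le> t * (2 * a + t * c)" using v by (simp add: c_def algebra_simps)
  moreover have "2 * a + t * c = a - t" using t by (simp add: algebra_simps)
  moreover have "t * (a - t) < 0"
    using a \<open>t < 0\<close> by (simp add: mult_neg_pos)
  ultimately show False by simp
qed

text \<open>The eigenvector maximises the quadratic form \<open>x \<bullet> f x\<close> on the unit sphere of \<open>S\<close>.\<close>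

lemma selfadjoint_eigenvector_in_subspace:
  fixes f :: "'a::euclidean_space \<Rightarrow> 'a"
  assumes lin: "linear f" and self: "\<And>x y. f x \<bullet> y = x \<bullet> f y"
    and S: "subspace S" "f ` S \<subseteq> S" "S \<noteq> {0}"
  obtains v l where "v \<in> S" "norm v = 1" "f v = l *\<^sub>R v"
proof -
  let ?K = "S \<inter> sphere 0 1"
  obtain s where s: "s \<in> S" "s \<noteq> 0" using S subspace_0 by blast
  have "compact ?K" using closed_Int_compact[OF closed_subspace[OF S(1)]] by simp
  moreover have "s /\<^sub>R norm s \<in> ?K" using s S by (simp add: subspace_scale)
  then have "?K \<noteq> {}" by blast
  moreover have "continuous_on ?K (\<lambda>x. x \<bullet> f x)"
    by (intro continuous_intros linear_continuous_on linear_conv_bounded_linear[THEN iffD1] lin)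
  ultimately obtain v where v: "v \<in> ?K" and max: "\<And>x. x \<in> ?K \<Longrightarrow> x \<bullet> f x \<le> v \<bullet> f v"
    using continuous_attains_sup by metis
  define l where "l = v \<bullet> f v"
  \<comment> \<open>Maximality of \<open>v\<close> makes the quadratic form of \<open>h\<close>
    nonnegative on \<open>S\<close> and zero at \<open>v\<close>; hence \<open>h v = 0\<close>,
    which is the eigenvalue equation.\<close>
  define h where "h x = l *\<^sub>R x - f x" for x
  have "h v = 0"
  proof (rule positive_semidefinite_kernel[where S = S and h = h and v = v])
    show "linear h"
      unfolding h_def by (intro linear_compose_sub lin linear_scale_self)
    show "h x \<bullet> y = x \<bullet> h y" for x y by (simp add: h_def inner_diff self)
    show "h ` S \<subseteq> S" using S by (auto simp: h_def subspace_diff subspace_scale)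
    show "v \<bullet> h v = 0" using v by (simp add: h_def inner_diff l_def norm_eq_1)
    \<comment> \<open>The bound on the unit sphere extends to all of \<open>S\<close> by homogeneity
      of degree two.\<close>
    show "0 \<le> x \<bullet> h x" if "x \<in> S" for x
    proof (cases "x = 0")
      case False
      have "x /\<^sub>R norm x \<in> ?K" using that False S by (simp add: subspace_scale)
      from max[OF this] have "(x \<bullet> f x) / (norm x)\<^sup>2 \<le> l"
        by (simp add: linear_scale[OF lin] l_def power2_eq_square divide_simps)
      then have "x \<bullet> f x \<le> l * (norm x)\<^sup>2" using False by (simp add: divide_simps)
      then show ?thesis by (simp add: h_def inner_diff power2_norm_eq_inner)
    qed simp
  qed (use v S in auto)
  then show ?thesis using that[of v l] v by (simp add: h_def)
qed

text \<open>The orthogonal complement of a set of eigenvectors is invariant under \<open>f\<close>.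
  If it were nonzero for an orthonormal set of largest size, it would contain a further unit
  eigenvector.\<close>

theorem selfadjoint_orthonormal_eigenbasis:
  fixes f :: "'a::euclidean_space \<Rightarrow> 'a"
  assumes lin: "linear f" and self: "\<And>x y. f x \<bullet> y = x \<bullet> f y"
  obtains E l where "finite E" "pairwise orthogonal E" "\<And>e. e \<in> E \<Longrightarrow> norm e = 1"
    "\<And>e. e \<in> E \<Longrightarrow> f e = l e *\<^sub>R e" "span E = UNIV"
proof -
  define P where "P E \<longleftrightarrow> pairwise orthogonal E \<and>
    (\<forall>e\<in>E. norm e = 1 \<and> (\<exists>l. f e = l *\<^sub>R e))" for E
  have fin: "finite E \<and> card E \<le> DIM('a)" if "P E" for E
  proof -
    have "independent E"
      using that by (intro pairwise_orthogonal_independent) (auto simp: P_def)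
    then show ?thesis by (rule independent_bound)
  qed
  have "P {}" by (simp add: P_def)
  \<comment> \<open>Orthonormal sets are independent, so their size is bounded by the dimension and
    a largest one exists; \<open>Suc\<close> makes the bound strict.\<close>
  then obtain E where E: "P E" and max: "\<And>F. P F \<Longrightarrow> card F \<le> card E"
    using ex_has_greatest_nat[of P "{}" card "Suc DIM('a)"] fin
    by (auto simp: less_Suc_eq_le)
  define S where "S = {y. \<forall>x\<in>E. orthogonal x y}"
  have "S = {0}"
  proof (rule ccontr)
    assume ne: "S \<noteq> {0}"
    have sub: "subspace S" unfolding S_def by (rule subspace_orthogonal_to_vectors)
    have inv: "f ` S \<subseteq> S"
    \<comment> \<open>Self-adjointness moves \<open>f\<close> from \<open>y\<close> to the
      eigenvector \<open>e\<close>, which only rescales \<open>e\<close>.\<close>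
    proof (clarsimp simp: S_def)
      fix y e assume y: "\<forall>x\<in>E. orthogonal x y" and e: "e \<in> E"
      obtain l where "f e = l *\<^sub>R e" using E e by (auto simp: P_def)
      then show "orthogonal e (f y)"
        using y e by (simp add: orthogonal_def self[symmetric])
    qed
    obtain v l where v: "v \<in> S" "norm v = 1" "f v = l *\<^sub>R v"
      using selfadjoint_eigenvector_in_subspace[OF lin self sub inv ne] .
    have "v \<notin> E" using v by (auto simp: S_def orthogonal_def norm_eq_1)
    moreover have "P (insert v E)"
      using E v by (auto simp: P_def S_def pairwise_insert orthogonal_commute)
    ultimately show False using max[of "insert v E"] fin[OF E] by simp
  qed
  have "span E = UNIV"
  proof (rule ccontr)
    assume "span E \<noteq> UNIV"
    then obtain a where "a \<noteq> 0" "\<And>x. x \<in> span E \<Longrightarrow> a \<bullet> x = 0"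
      using span_not_UNIV_orthogonal by blast
    then have "a \<in> S" by (simp add: S_def orthogonal_def inner_commute span_base)
    then show False using \<open>S = {0}\<close> \<open>a \<noteq> 0\<close> by simp
  qed
  moreover obtain l where "\<And>e. e \<in> E \<Longrightarrow> f e = l e *\<^sub>R e"
    using E unfolding P_def by metis
  ultimately show ?thesis using that[of E l] E fin[OF E] by (simp add: P_def)
qed

section \<open>Positive semidefinite matrices and their square roots\<close>

text \<open>Symmetry is included so that this is exactly the condition on \<open>B\<close> in the
  description \<open>matrix_sqrt\<close>, apart from \<open>B ** B = A\<close>.\<close>

definition psd_matrix :: "real^'n^'n \<Rightarrow> bool" where
  "psd_matrix A \<longleftrightarrow> transpose A = A \<and> (\<forall>x. 0 \<le> x \<bullet> (A *v x))"

lemma symmetric_matrix_selfadjoint: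
  fixes A :: "real^'n^'n"
  assumes "transpose A = A"
  shows "(A *v x) \<bullet> y = x \<bullet> (A *v y)"
  by (simp add: inner_matrix_transpose assms)

lemma psd_matrix_kernel:
  assumes "psd_matrix A" "v \<bullet> (A *v v) = 0"
  shows "A *v v = 0"
  using positive_semidefinite_kernel[of "(*v) A" UNIV v] assms
  by (simp add: psd_matrix_def symmetric_matrix_selfadjoint matrix_vector_mul_linear)

text \<open>Keep an orthonormal eigenbasis of \<open>A\<close> and replace each eigenvalue,
  nonnegative by semidefiniteness, by its square root.\<close>

lemma psd_matrix_sqrt_exists:
  fixes A :: "real^'n^'n"
  assumes A: "psd_matrix A"
  obtains B where "psd_matrix B" "B ** B = A"
proof -
  have lin: "linear ((*v) A)" by simp
  obtain E l where E: "finite E" "pairwise orthogonal E" "\<And>e. e \<in> E \<Longrightarrow> norm e = 1"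
    "\<And>e. e \<in> E \<Longrightarrow> A *v e = l e *\<^sub>R e" "span E = UNIV"
    using selfadjoint_orthonormal_eigenbasis[OF lin] symmetric_matrix_selfadjoint A
    unfolding psd_matrix_def by metis
  have l: "l e \<ge> 0" if "e \<in> E" for e
  proof -
    have "0 \<le> e \<bullet> (A *v e)" using A by (simp add: psd_matrix_def)
    then show ?thesis using E that by (simp add: norm_eq_1)
  qed
  have ee: "d \<bullet> e = (if d = e then 1 else 0)" if "d \<in> E" "e \<in> E" for d e
    using E that by (auto simp: norm_eq_1 pairwise_def orthogonal_def)
  define g where "g x = (\<Sum>e\<in>E. (sqrt (l e) * (x \<bullet> e)) *\<^sub>R e)" for x
  define B where "B = matrix g"
  have "linear g"
    unfolding g_def by (rule linearI)
      (simp_all add: algebra_simps sum.distrib scaleR_sum_right)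
  then have B: "B *v x = g x" for x by (simp add: B_def matrix_works)
  have ge: "g e = sqrt (l e) *\<^sub>R e" if "e \<in> E" for e
  proof -
    have "g e = (\<Sum>d\<in>E. if d = e then sqrt (l e) *\<^sub>R e else 0)"
      unfolding g_def using that by (intro sum.cong) (auto simp: ee)
    then show ?thesis using E that by simp
  qed
  \<comment> \<open>This expression is symmetric in \<open>x\<close> and \<open>y\<close> and a sum
    of nonnegative terms for \<open>x = y\<close>, so it yields both symmetry and semidefiniteness
    of \<open>B\<close>.\<close>
  have gxy: "x \<bullet> g y = (\<Sum>e\<in>E. sqrt (l e) * (x \<bullet> e) * (y \<bullet> e))" for x y
    by (simp add: g_def inner_sum_right mult_ac)
  have "x \<bullet> (transpose B *v y) = x \<bullet> (B *v y)" for x y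
  proof -
    have "x \<bullet> (transpose B *v y) = g x \<bullet> y"
      by (simp only: inner_matrix_transpose transpose_transpose B)
    also have "\<dots> = x \<bullet> (B *v y)"
      by (subst inner_commute) (simp add: gxy B mult_ac)
    finally show ?thesis .
  qed
  then have "transpose B *v y = B *v y" for y
    using vector_eq_ldot[of "transpose B *v y" "B *v y"] by blast
  then have "transpose B = B"
    by (intro matrix_eq[THEN iffD2] allI)
  moreover have "0 \<le> x \<bullet> (B *v x)" for x
    by (auto simp: B gxy l mult.assoc intro!: sum_nonneg mult_nonneg_nonneg[OF _ zero_le_square])
  moreover have "B ** B = A"
    unfolding matrix_eq
  proof
    fix x
    \<comment> \<open>Agreement on \<open>E\<close> suffices, since \<open>E\<close> spans the
      space.\<close>
    have eq: "B ** B *v e = A *v e" if "e \<in> E" for e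
      using that l by (simp add: matrix_vector_mul_assoc[symmetric] B ge E
          linear_scale[OF \<open>linear g\<close>])
    show "B ** B *v x = A *v x"
      using linear_eq_on[of "(*v) (B ** B)" "(*v) A" x E] eq E(5) by simp
  qed
  ultimately show ?thesis using that[of B] by (simp add: psd_matrix_def)
qed

text \<open>The difference \<open>X = B - C\<close> of two square roots satisfies \<open>B X + X C = 0\<close>, so an
  eigenvector of \<open>X\<close> for a nonzero eigenvalue would lie in the kernels of \<open>B\<close> and \<open>C\<close>.\<close>

lemma psd_matrix_sqrt_unique:
  fixes B C :: "real^'n^'n"
  assumes B: "psd_matrix B" and C: "psd_matrix C" and eq: "B ** B = C ** C"
  shows "B = C"
proof -
  define X where "X = B - C"
  have Xv: "X *v v = B *v v - C *v v" for v
    by (simp add: X_def matrix_vector_mult_diff_rdistrib)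
  have symB: "(B *v x) \<bullet> y = x \<bullet> (B *v y)" and symC: "(C *v x) \<bullet> y = x \<bullet> (C *v y)" for x y
    using B C by (simp_all add: psd_matrix_def symmetric_matrix_selfadjoint)
  have symX: "(X *v x) \<bullet> y = x \<bullet> (X *v y)" for x y
    by (simp add: Xv inner_diff symB symC)
  have lin: "linear ((*v) X)" by simp
  obtain E l where E: "\<And>e. e \<in> E \<Longrightarrow> X *v e = l e *\<^sub>R e" "span E = UNIV"
    using selfadjoint_orthonormal_eigenbasis[OF lin symX] by metis
  have ker: "X *v e = 0" if e: "e \<in> E" for e
  proof (cases "l e = 0")
    case False
    have "B *v (B *v e) = C *v (C *v e)" by (simp add: matrix_vector_mul_assoc eq)
    then have "B *v (X *v e) + X *v (C *v e) = 0"
      by (simp add: Xv matrix_vector_mult_diff_distrib)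
    then have "e \<bullet> (B *v (X *v e)) + e \<bullet> (X *v (C *v e)) = 0"
      by (metis inner_add_right inner_zero_right)
    \<comment> \<open>Symmetry of \<open>X\<close> lets it act on \<open>e\<close> in the second
      term; in both terms it contributes the factor \<open>l e\<close>. Both remaining summands are
      nonnegative, so each vanishes.\<close>
    then have "l e * (e \<bullet> (B *v e) + e \<bullet> (C *v e)) = 0"
      using E(1)[OF e] by (simp add: symX[symmetric] matrix_vector_mult_scaleR algebra_simps)
    moreover have "0 \<le> e \<bullet> (B *v e)" "0 \<le> e \<bullet> (C *v e)"
      using B C by (simp_all add: psd_matrix_def)
    ultimately have "e \<bullet> (B *v e) = 0" "e \<bullet> (C *v e) = 0"
      using False by auto
    then have "B *v e = 0" "C *v e = 0" using B C psd_matrix_kernel by auto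
    then show ?thesis by (simp add: Xv)
  qed (simp add: E e)
  have "X *v x = 0" for x
    using linear_eq_on[OF lin linear_zero, of x E] ker E(2) by simp
  then show ?thesis unfolding matrix_eq by (simp add: Xv)
qed

text \<open>Existence and uniqueness together make the definite description in
  \<open>matrix_sqrt\<close> meaningful.\<close>

lemma matrix_sqrt_psd:
  fixes A :: "real^'n^'n"
  assumes "psd_matrix A"
  shows "psd_matrix (matrix_sqrt A)" and "matrix_sqrt A ** matrix_sqrt A = A"
proof -
  obtain B where "psd_matrix B" "B ** B = A" using psd_matrix_sqrt_exists[OF assms] .
  then have "\<exists>!B. psd_matrix B \<and> B ** B = A"
    using psd_matrix_sqrt_unique by metis
  moreover have "matrix_sqrt A = (THE B. psd_matrix B \<and> B ** B = A)"
    by (simp add: matrix_sqrt_def psd_matrix_def conj_assoc)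
  ultimately show "psd_matrix (matrix_sqrt A)" "matrix_sqrt A ** matrix_sqrt A = A"
    using theI'[of "\<lambda>B. psd_matrix B \<and> B ** B = A"] by simp_all
qed

section \<open>Inverses and the inverse square root\<close>

lemma matrix_inv_inverse:
  assumes "invertible A"
  shows "A ** matrix_inv A = mat 1" and "matrix_inv A ** A = mat 1"
  using assms someI_ex[of "\<lambda>A'. A ** A' = mat 1 \<and> A' ** A = mat 1"]
  by (simp_all add: matrix_inv_def invertible_def)

lemma matrix_inv_eqI:
  assumes "A ** B = mat 1" "B ** A = mat 1"
  shows "matrix_inv A = B"
proof -
  have "invertible A" using assms by (auto simp: invertible_def)
  then have "matrix_inv A ** (A ** B) = B"
    by (simp add: matrix_mul_assoc matrix_inv_inverse)
  then show ?thesis using assms by simp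
qed

text \<open>The inverse \<open>R\<close> of the symmetric root \<open>B\<close> is itself symmetric,
  so the product is \<open>R ** R\<close>, the inverse of \<open>B ** B\<close>.\<close>

lemma matrix_inv_sqrt_square:
  fixes A :: "real^'n^'n"
  assumes A: "psd_matrix A" "invertible A"
  shows "transpose (matrix_inv_sqrt A) ** matrix_inv_sqrt A = matrix_inv A"
proof -
  define B where "B = matrix_sqrt A"
  have B: "transpose B = B" "B ** B = A"
    using matrix_sqrt_psd[OF A(1)] by (simp_all add: B_def psd_matrix_def)
  have "B ** (B ** matrix_inv A) = mat 1"
    by (simp add: matrix_mul_assoc B matrix_inv_inverse A)
  then have "invertible B" by (auto simp: invertible_right_inverse)
  note inv = matrix_inv_inverse[OF this]
  define R where "R = matrix_inv B"
  have BR: "B ** R = mat 1" and RB: "R ** B = mat 1" using inv by (simp_all add: R_def)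
  \<comment> \<open>Transposing \<open>B ** R = mat 1\<close> and \<open>R ** B = mat 1\<close>
    shows that \<open>transpose R\<close> also inverts \<open>B\<close>; inverses are
    unique.\<close>
  have "transpose R ** B = mat 1" "B ** transpose R = mat 1"
    using BR RB B(1) by (metis matrix_transpose_mul transpose_mat)+
  then have R: "transpose R = R"
    using matrix_inv_eqI[of B "transpose R"] by (simp add: R_def)
  have "A ** (R ** R) = B ** (B ** R) ** R" "(R ** R) ** A = R ** (R ** B) ** B"
    by (simp_all add: B(2)[symmetric] matrix_mul_assoc)
  then have "matrix_inv A = R ** R"
    by (intro matrix_inv_eqI) (simp_all add: BR RB)
  then show ?thesis by (simp add: R matrix_inv_sqrt_def flip: B_def R_def)
qed

section \<open>The weighted Gram matrix and the formula for \<open>H\<close>\<close>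

lemma diag_matrix_mult_vec: "diag_matrix d *v x = (\<chi> i. d $ i * x $ i)"
  by (simp add: diag_matrix_def matrix_vector_mult_def vec_eq_iff if_distrib[of "\<lambda>a. a * _"]
      cong: if_cong)

lemma transpose_diag_matrix: "transpose (diag_matrix d) = diag_matrix d"
  by (simp add: transpose_def diag_matrix_def vec_eq_iff)

text \<open>The quadratic form of \<open>A\<close> is a sum of squares of the entries of
  \<open>transpose Gt *v x\<close> with positive weights. Full row rank makes
  \<open>transpose Gt\<close> injective, so the form vanishes only at zero and \<open>A\<close> has
  trivial kernel.\<close>

lemma weighted_gram_matrix:
  fixes Gt :: "real^'k^'q"
  assumes pos: "\<And>i. d $ i > 0" and rank: "rank Gt = CARD('q)"
  defines "A \<equiv> Gt ** diag_matrix d ** transpose Gt"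
  shows "psd_matrix A" and "invertible A"
proof -
  have quad: "x \<bullet> (A *v x) = (\<Sum>i\<in>UNIV. d $ i * ((transpose Gt *v x) $ i)\<^sup>2)" for x
  proof -
    have "x \<bullet> (A *v x) = (transpose Gt *v x) \<bullet> (diag_matrix d *v (transpose Gt *v x))"
      by (simp add: A_def inner_matrix_transpose flip: matrix_vector_mul_assoc)
    then show ?thesis
      by (simp add: diag_matrix_mult_vec inner_vec_def power2_eq_square mult_ac)
  qed
  have nonneg: "0 \<le> d $ i * t\<^sup>2" for i t
    using pos[of i] by simp
  have "0 \<le> x \<bullet> (A *v x)" for x
    unfolding quad by (intro sum_nonneg nonneg)
  moreover have "transpose A = A"
    by (simp add: A_def matrix_transpose_mul transpose_diag_matrix matrix_mul_assoc)
  ultimately show "psd_matrix A" by (simp add: psd_matrix_def)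
  have inj: "inj ((*v) (transpose Gt))"
    using rank by (simp add: rank_transpose flip: full_rank_injective)
  have "x = 0" if "A *v x = 0" for x
  proof -
    have "(\<Sum>i\<in>UNIV. d $ i * ((transpose Gt *v x) $ i)\<^sup>2) = 0"
      using that quad[of x] by simp
    then have "\<forall>i\<in>UNIV. d $ i * ((transpose Gt *v x) $ i)\<^sup>2 = 0"
      by (subst (asm) sum_nonneg_eq_0_iff) (simp_all add: nonneg)
    then have "(transpose Gt *v x) $ i = 0" for i
      using pos[of i] by (metis UNIV_I less_irrefl mult_eq_0_iff power_eq_0_iff)
    then have "transpose Gt *v x = transpose Gt *v 0"
      by (simp only: vec_eq_iff matrix_vector_mult_0_right zero_index simp_thms)
    then show "x = 0" by (rule injD[OF inj])
  qed
  then show "invertible A"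
    by (simp add: invertible_left_inverse matrix_left_invertible_ker)
qed

lemma H_matrix_eq:
  fixes Gt :: "real^'k^'q"
  assumes "\<And>i. 1 \<le> n i" and "rank Gt = CARD('q)"
  shows "H_matrix n Gt = transpose Gt ** matrix_inv (Gt ** D_matrix n ** transpose Gt) ** Gt"
proof -
  define A where "A = Gt ** D_matrix n ** transpose Gt"
  have "real (n i) > 0" for i using assms(1)[of i] by simp
  then have A: "psd_matrix A" "invertible A"
    unfolding A_def D_matrix_def using assms by (auto intro!: weighted_gram_matrix)
  have "H_matrix n Gt = transpose Gt ** (transpose (matrix_inv_sqrt A) ** matrix_inv_sqrt A) ** Gt"
    by (simp add: H_matrix_def G_matrix_def matrix_transpose_mul matrix_mul_assoc A_def)
  then show ?thesis by (simp add: matrix_inv_sqrt_square A flip: A_def)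
qed

section \<open>Kronecker products and the two forms of the integrand\<close>

lemma kronecker_mult:
  fixes A :: "real^'n^'m" and B :: "real^'b^'a" and C :: "real^'l^'n" and D :: "real^'c^'b"
  shows "kronecker A B ** kronecker C D = kronecker (A ** C) (B ** D)"
proof -
  have "(\<Sum>k\<in>UNIV. A $ i $ fst k * B $ j $ snd k * (C $ fst k $ s * D $ snd k $ t)) =
    (\<Sum>k\<in>UNIV. A $ i $ k * C $ k $ s) * (\<Sum>k\<in>UNIV. B $ j $ k * D $ k $ t)" for i j s t
    unfolding sum_product by (simp add: sum.cartesian_product' mult_ac flip: UNIV_Times_UNIV)
  then show ?thesis by (simp add: kronecker_def matrix_matrix_mult_def vec_eq_iff)
qed

lemma transpose_kronecker: "transpose (kronecker A B) = kronecker (transpose A) (transpose B)"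
  by (simp add: kronecker_def transpose_def vec_eq_iff)

text \<open>The identity factor leaves only diagonal blocks. The resulting sum is linear in the
  entries of \<open>A\<close>, so that integration over \<delta> can act entry by entry.\<close>

lemma kronecker_mat_1_quadratic_form:
  fixes A :: "real^'p^'p" and u :: "real^('q::finite \<times> 'p::finite)"
  shows "u \<bullet> (kronecker (mat 1) A *v u) =
    (\<Sum>j\<in>UNIV. \<Sum>a\<in>UNIV. \<Sum>b\<in>UNIV. A $ a $ b * (u $ (j, a) * u $ (j, b)))"
proof -
  have "(kronecker (mat 1) A *v u) $ (j, a) = (\<Sum>b\<in>UNIV. A $ a $ b * u $ (j, b))" for j a
  proof -
    have "(kronecker (mat 1) A *v u) $ (j, a) =
        (\<Sum>i\<in>UNIV. \<Sum>b\<in>UNIV. (if j = i then 1 else 0) * A $ a $ b * u $ (i, b))"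
      by (simp add: kronecker_def matrix_vector_mult_def mat_def sum.cartesian_product'
          flip: UNIV_Times_UNIV)
    also have "\<dots> = (\<Sum>i\<in>UNIV. if j = i then \<Sum>b\<in>UNIV. A $ a $ b * u $ (i, b) else 0)"
      by (intro sum.cong) auto
    finally show ?thesis by simp
  qed
  then show ?thesis
    by (simp add: inner_vec_def sum.cartesian_product' sum_distrib_left mult_ac
        flip: UNIV_Times_UNIV)
qed

lemma outer_component: "outer v $ a $ b = v $ a * v $ b"
  by (simp add: outer_def matrix_matrix_mult_def columnvector_def rowvector_def)

lemma W_matrix_component:
  "W_matrix \<alpha> \<beta> $ a $ b = (if a = b then (\<beta> $ a)\<^sup>2 + (\<alpha> $ a)\<^sup>2 else \<alpha> $ a * \<alpha> $ b)"
  by (simp add: W_matrix_def diag_matrix_def outer_component power2_eq_square)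

text \<open>By the mixed product rule, \<open>transpose ?R ** ?R\<close> is the Kronecker product of
  the identity with \<open>outer \<delta>\<close>.\<close>

lemma T_norm_integrand_eq:
  fixes C :: "real^('k::finite \<times> 'p::finite)^('q::finite \<times> 'p)"
  shows "T_norm_integrand C w m = T_integrand C w m"
proof
  fix \<delta> :: "real^'p"
  let ?R = "kronecker (mat 1 :: real^'q^'q) (rowvector \<delta> :: real^'p^1)"
  have "(norm (?R *v u))\<^sup>2 = u \<bullet> (kronecker (mat 1) (outer \<delta>) *v u)" for u
  proof -
    have "transpose ?R ** ?R = kronecker (mat 1) (outer \<delta>)"
      by (simp add: transpose_kronecker kronecker_mult transpose_rowvector outer_def)
    then have "u \<bullet> (kronecker (mat 1) (outer \<delta>) *v u) = u \<bullet> (transpose ?R *v (?R *v u))"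
      by (simp add: matrix_vector_mul_assoc)
    also have "\<dots> = (?R *v u) \<bullet> (?R *v u)"
      by (simp only: inner_matrix_transpose transpose_transpose)
    finally show ?thesis by (simp only: power2_norm_eq_inner)
  qed
  then show "T_norm_integrand C w m \<delta> = T_integrand C w m \<delta>"
    by (simp only: T_norm_integrand_def T_integrand_def)
qed

section \<open>Moments of a product density\<close>

text \<open>Lebesgue measure on \<open>real^'p\<close> is the image of the product measure indexed
  by \<open>Basis\<close>, where the integral of a product of one-variable functions factors. The
  work is in passing from \<open>Basis\<close> to the index type \<open>'p\<close>.\<close>

lemma has_bochner_integral_lborel_prod:
  fixes h :: "'p::finite \<Rightarrow> real \<Rightarrow> real"
  assumes h: "\<And>i. has_bochner_integral lborel (h i) (c i)"
  shows "has_bochner_integral lborel (\<lambda>x::real^'p. \<Prod>i\<in>UNIV. h i (x $ i)) (\<Prod>i\<in>UNIV. c i)"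
proof -
  let ?ax = "\<lambda>i::'p. axis i (1::real)"
  let ?P = "\<Pi>\<^sub>M b\<in>(Basis :: (real^'p) set). (lborel :: real measure)"
  let ?T = "\<lambda>f. \<Sum>b\<in>(Basis :: (real^'p) set). f b *\<^sub>R b"
  \<comment> \<open>The family \<open>h\<close> reindexed along the inverse of the bijection
    \<open>?ax\<close>.\<close>
  define k where "k b = h (THE i. b = ?ax i)" for b
  have bij: "bij_betw ?ax UNIV Basis"
    by (auto simp: bij_betw_def inj_on_def axis_eq_axis Basis_vec_def)
  have k: "k (?ax i) = h i" for i by (simp add: k_def axis_eq_axis)
  have int: "integrable lborel (h i)" and val: "integral\<^sup>L lborel (h i) = c i" for i
    using h[of i] by (simp_all add: has_bochner_integral_iff)
  have kint: "integrable lborel (k b)" if "b \<in> Basis" for b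
    using that int by (auto simp: Basis_vec_def k)
  have comp: "?T f $ i = f (?ax i)" for f :: "real^'p \<Rightarrow> real" and i
  proof -
    have "?T f $ i = ?T f \<bullet> ?ax i" by (simp add: inner_axis)
    then show ?thesis by (simp add: inner_sum_left_Basis)
  qed
  interpret product_sigma_finite "\<lambda>b::real^'p. lborel :: real measure" by standard
  have T: "?T \<in> ?P \<rightarrow>\<^sub>M borel" by measurable
  have re: "(\<Prod>i\<in>UNIV. h i (?T f $ i)) = (\<Prod>b\<in>Basis. k b (f b))" for f :: "real^'p \<Rightarrow> real"
    unfolding comp by (subst prod.reindex_bij_betw[OF bij, symmetric]) (simp add: k)
  have meas: "(\<lambda>x::real^'p. \<Prod>i\<in>UNIV. h i (x $ i)) \<in> borel_measurable borel"
    using int[THEN borel_measurable_integrable] by measurable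
  have "has_bochner_integral ?P (\<lambda>f. \<Prod>b\<in>Basis. k b (f b)) (\<Prod>b\<in>Basis. integral\<^sup>L lborel (k b))"
    using product_integrable_prod[of Basis k] product_integral_prod[of Basis k] kint
    by (simp add: has_bochner_integral_iff)
  also have "(\<Prod>b\<in>Basis. integral\<^sup>L lborel (k b)) = (\<Prod>i\<in>UNIV. c i)"
    by (subst prod.reindex_bij_betw[OF bij, symmetric]) (simp add: k val)
  finally have "has_bochner_integral ?P (\<lambda>f. \<Prod>i\<in>UNIV. h i (?T f $ i)) (\<Prod>i\<in>UNIV. c i)"
    by (simp only: re)
  then have "has_bochner_integral (distr ?P borel ?T)
      (\<lambda>x::real^'p. \<Prod>i\<in>UNIV. h i (x $ i)) (\<Prod>i\<in>UNIV. c i)"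
    unfolding has_bochner_integral_iff
    by (simp only: integrable_distr_eq[OF T meas] integral_distr[OF T meas])
  then show ?thesis by (simp only: lborel_eq[where 'a = "real^'p"])
qed

text \<open>Expand \<open>x\<^sup>2 = (x - m)\<^sup>2 + 2 * m * x - m\<^sup>2\<close> and integrate
  term by term.\<close>

lemma second_moment_of_mean_variance:
  assumes "prob_density_fun f" "has_mean_variance f m v"
  shows "has_bochner_integral lborel (\<lambda>x. x\<^sup>2 * f x) (v + m\<^sup>2)"
proof -
  have "has_bochner_integral lborel
      (\<lambda>x. (x - m)\<^sup>2 * f x + (2 * m * (x * f x) - m\<^sup>2 * f x)) (v + (2 * m * m - m\<^sup>2 * 1))"
    using assms unfolding prob_density_fun_def has_mean_variance_def
    by (intro has_bochner_integral_add has_bochner_integral_diff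
        has_bochner_integral_mult_right) auto
  moreover have "(\<lambda>x. (x - m)\<^sup>2 * f x + (2 * m * (x * f x) - m\<^sup>2 * f x)) = (\<lambda>x. x\<^sup>2 * f x)"
    by (simp add: fun_eq_iff power2_eq_square algebra_simps)
  moreover have "v + (2 * m * m - m\<^sup>2 * 1) = v + m\<^sup>2"
    by (simp add: power2_eq_square)
  ultimately show ?thesis by (simp only:)
qed

lemma prod_density_moments:
  assumes dens: "\<And>i. prob_density_fun (w i)"
    and mom: "\<And>i. has_mean_variance (w i) (\<alpha> $ i) ((\<beta> $ i)\<^sup>2)"
  shows "has_bochner_integral lborel (\<lambda>\<delta>. \<delta> $ a * \<delta> $ b * prod_density w \<delta>)
    (W_matrix \<alpha> \<beta> $ a $ b)"
proof -
  \<comment> \<open>The exponent of coordinate \<open>i\<close> in the monomial: it is 2 exactly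
    when \<open>i = a = b\<close>, which treats diagonal and off-diagonal entries together.
    Accordingly \<open>c i\<close> is the moment of order 0, 1 or 2 of \<open>w i\<close>.\<close>
  define k :: "'a \<Rightarrow> nat" where "k i = of_bool (i = a) + of_bool (i = b)" for i
  define c where "c i = (if k i = 0 then 1 else if k i = 1 then \<alpha> $ i
    else (\<beta> $ i)\<^sup>2 + (\<alpha> $ i)\<^sup>2)" for i
  have "has_bochner_integral lborel (\<lambda>x. x ^ k i * w i x) (c i)" for i
    using dens[of i] mom[of i] second_moment_of_mean_variance[OF dens mom, of i]
    by (auto simp: k_def c_def prob_density_fun_def has_mean_variance_def numeral_2_eq_2)
  from has_bochner_integral_lborel_prod[OF this]
  have "has_bochner_integral lborel (\<lambda>\<delta>::real^'a. \<Prod>i\<in>UNIV. \<delta> $ i ^ k i * w i (\<delta> $ i))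
    (\<Prod>i\<in>UNIV. c i)" .
  moreover have "(\<Prod>i\<in>UNIV. x i ^ of_bool (i = d)) = (x d :: real)" for x and d :: 'a
  proof -
    have "(\<Prod>i\<in>UNIV. x i ^ of_bool (i = d)) = (\<Prod>i\<in>UNIV. if i = d then x i else 1)"
      by (intro prod.cong) auto
    then show ?thesis by simp
  qed
  then have "(\<Prod>i\<in>UNIV. \<delta> $ i ^ k i * w i (\<delta> $ i)) = \<delta> $ a * \<delta> $ b * prod_density w \<delta>" for \<delta>
    by (simp add: k_def power_add prod.distrib prod_density_def)
  moreover have "(\<Prod>i\<in>UNIV. c i) = W_matrix \<alpha> \<beta> $ a $ b"
  proof -
    \<comment> \<open>Every other coordinate contributes the total mass 1 of its density.\<close>
    have "(\<Prod>i\<in>UNIV. c i) = (\<Prod>i\<in>{a, b}. c i)"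
      by (rule prod.mono_neutral_right) (auto simp: c_def k_def)
    then show ?thesis by (auto simp: c_def k_def W_matrix_component)
  qed
  ultimately show ?thesis by simp
qed

section \<open>Integration of the quadratic form and the closed formula\<close>

lemma has_bochner_integral_T_integrand:
  fixes C :: "real^('k::finite \<times> 'p::finite)^('q::finite \<times> 'p)"
  assumes dens: "\<And>i. prob_density_fun (w i)"
    and mom: "\<And>i. has_mean_variance (w i) (\<alpha> $ i) ((\<beta> $ i)\<^sup>2)"
  shows "has_bochner_integral lborel (T_integrand C w m)
    ((C *v m) \<bullet> (kronecker (mat 1) (W_matrix \<alpha> \<beta>) *v (C *v m)))"
proof -
  define u where "u = C *v m"
  have "has_bochner_integral lborel
      (\<lambda>\<delta>. \<Sum>j\<in>UNIV. \<Sum>a\<in>UNIV. \<Sum>b\<in>UNIV.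
        (\<delta> $ a * \<delta> $ b * prod_density w \<delta>) * (u $ (j, a) * u $ (j, b)))
      (\<Sum>j\<in>UNIV. \<Sum>a\<in>UNIV. \<Sum>b\<in>UNIV. W_matrix \<alpha> \<beta> $ a $ b * (u $ (j, a) * u $ (j, b)))"
    by (intro has_bochner_integral_sum has_bochner_integral_mult_left prod_density_moments assms)
  moreover have "T_integrand C w m = (\<lambda>\<delta>. \<Sum>j\<in>UNIV. \<Sum>a\<in>UNIV. \<Sum>b\<in>UNIV.
      (\<delta> $ a * \<delta> $ b * prod_density w \<delta>) * (u $ (j, a) * u $ (j, b)))"
    by (simp add: fun_eq_iff T_integrand_def kronecker_mat_1_quadratic_form outer_component
        sum_distrib_left mult_ac flip: u_def)
  ultimately show ?thesis by (simp only: kronecker_mat_1_quadratic_form u_def)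
qed

theorem theorem1:
  fixes M :: "'w measure"
    and n :: "'k::finite \<Rightarrow> nat"
    and y :: "'k \<Rightarrow> nat \<Rightarrow> 'w \<Rightarrow> real^'p::finite"
    and \<mu> :: "'k \<Rightarrow> real^'p"
    and \<Sigma> :: "'k \<Rightarrow> real^'p^'p"
    and Gt :: "real^'k^'q::finite"
    and w :: "'p \<Rightarrow> real \<Rightarrow> real"
    and \<alpha> \<beta> :: "real^'p"
    and \<omega> :: 'w
  assumes "k_samples M n y \<mu> \<Sigma>"
    and "rank Gt = CARD('q)"
    and "CARD('q) < CARD('k)"
    and "\<And>i. prob_density_fun (w i)"
    and "\<And>i. has_mean_variance (w i) (\<alpha> $ i) ((\<beta> $ i)\<^sup>2)"
    and "\<omega> \<in> space M"
  shows "integrable lborel (T_integrand (C_matrix n Gt) w (mu_hat n y \<omega>)) \<and>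
         integrable lborel (T_norm_integrand (C_matrix n Gt) w (mu_hat n y \<omega>)) \<and>
         T_stat (C_matrix n Gt) w (mu_hat n y \<omega>) =
           (\<integral>\<delta>. T_norm_integrand (C_matrix n Gt) w (mu_hat n y \<omega>) \<delta> \<partial>lborel) \<and>
         H_matrix n Gt = transpose Gt ** matrix_inv (Gt ** D_matrix n ** transpose Gt) ** Gt \<and>
         T_stat (C_matrix n Gt) w (mu_hat n y \<omega>) =
           mu_hat n y \<omega> \<bullet> (kronecker (H_matrix n Gt) (W_matrix \<alpha> \<beta>) *v mu_hat n y \<omega>)"
proof -
  define C :: "real^('k \<times> 'p)^('q \<times> 'p)" where "C = C_matrix n Gt"
  define m where "m = mu_hat n y \<omega>"
  have n: "1 \<le> n i" for i using assms(1) by (simp add: k_samples_def k_samples_axioms_def)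
  let ?K = "kronecker (mat 1 :: real^'q^'q) (W_matrix \<alpha> \<beta>)"
  have "m \<bullet> (transpose C *v (?K *v (C *v m))) = (C *v m) \<bullet> (?K *v (C *v m))"
    by (simp only: inner_matrix_transpose[of m] transpose_transpose)
  \<comment> \<open>The mixed product rule acts factorwise: the first factors give
    \<open>transpose G ** G\<close>, that is \<open>H\<close>, and the identities leave
    \<open>W_matrix \<alpha> \<beta>\<close> unchanged.\<close>
  moreover have "transpose C ** (?K ** C) = kronecker (H_matrix n Gt) (W_matrix \<alpha> \<beta>)"
    by (simp add: C_def C_matrix_def H_matrix_def transpose_kronecker kronecker_mult)
  ultimately have "(C *v m) \<bullet> (?K *v (C *v m)) =
      m \<bullet> (kronecker (H_matrix n Gt) (W_matrix \<alpha> \<beta>) *v m)"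
    by (simp only: matrix_vector_mul_assoc)
  \<comment> \<open>This carries integrability and the value at once; equality of the two integrands
    transfers both to the norm form.\<close>
  then have "has_bochner_integral lborel (T_integrand C w m)
      (m \<bullet> (kronecker (H_matrix n Gt) (W_matrix \<alpha> \<beta>) *v m))"
    using has_bochner_integral_T_integrand[OF assms(4,5), of C m] by simp
  then show ?thesis
    using H_matrix_eq[of n Gt, OF n assms(2)]
    by (simp add: T_stat_def T_norm_integrand_eq has_bochner_integral_iff flip: C_def m_def)
qed

end
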